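(* Let $G=(V,E)$ be a connected graph and $c:V\to\mathbb{N}$ with $c_v\le d(v)$ for every $v\in V$. Run the following Edge Deletion algorithm: start with $Y=E$; go through the edges $e=(u,v)$ of $Y$ one by one (in any order), and delete $e$ from $Y$ if at that moment $d_Y(u)>c_u$ and $d_Y(v)>c_v$, where $d_Y(x)$ is the current degree of $x$ in $(V,Y)$; return the final $Y$. Then this algorithm has approximation ratio $2$ for PDBEP: the returned $Y$ is feasible and $|Y|\ge \mathrm{OPT}/2$.
   Context: Partial Degree Bounded Edge Packing (PDBEP): given a graph $G=(V,E)$ and $c:V\to\mathbb{N}$, a set $E'\subseteq E$ is feasible if for every edge $(u,v)\in E'$ we have $d'_u\le c_u$ or $d'_v\le c_v$, where $d'_x$ denotes the degree of $x$ in $(V,E')$. $\mathrm{OPT}$ is the maximum cardinality of a feasible set. $d(v)$ denotes the degree of $v$ in $G$. *)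

theory Defs
  imports Complex_Main
begin

text \<open>Finite simple undirected graphs: an edge is the two-element set of its endpoints.\<close>

definition simple_graph :: "'v set \<Rightarrow> 'v set set \<Rightarrow> bool" where
  "simple_graph V E \<longleftrightarrow> finite V \<and> (\<forall>e\<in>E. e \<subseteq> V \<and> card e = 2)"

definition connected_graph :: "'v set \<Rightarrow> 'v set set \<Rightarrow> bool" where
  "connected_graph V E \<longleftrightarrow>
     simple_graph V E \<and> V \<noteq> {} \<and> (\<forall>u\<in>V. \<forall>v\<in>V. (u, v) \<in> {(x, y). {x, y} \<in> E}\<^sup>*)"

definition degree :: "'v set set \<Rightarrow> 'v \<Rightarrow> nat" where
  "degree F v = card {e \<in> F. v \<in> e}"

definition feasible :: "'v set set \<Rightarrow> ('v \<Rightarrow> nat) \<Rightarrow> 'v set set \<Rightarrow> bool" where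
  "feasible E c F \<longleftrightarrow>
     F \<subseteq> E \<and> (\<forall>u v. {u, v} \<in> F \<longrightarrow> degree F u \<le> c u \<or> degree F v \<le> c v)"

text \<open>For finite \<^term>\<open>E\<close> the maximum is taken over a finite set, which is nonempty since
  \<^term>\<open>{}\<close> is feasible.\<close>

definition OPT :: "'v set set \<Rightarrow> ('v \<Rightarrow> nat) \<Rightarrow> nat" where
  "OPT E c = Max {card F | F. feasible E c F}"

definition delete_step :: "('v \<Rightarrow> nat) \<Rightarrow> 'v set \<Rightarrow> 'v set set \<Rightarrow> 'v set set" where
  "delete_step c e Y = (if \<forall>x\<in>e. degree Y x > c x then Y - {e} else Y)"

text \<open>The list \<^term>\<open>es\<close> is the order in which the edges are examined; a run of the
  algorithm is given by a list that enumerates \<^term>\<open>E\<close> without repetition.\<close>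

definition edge_deletion :: "'v set set \<Rightarrow> ('v \<Rightarrow> nat) \<Rightarrow> 'v set list \<Rightarrow> 'v set set" where
  "edge_deletion E c es = fold (delete_step c) es E"

end

theory Submission
  imports Defs
begin

text \<open>A deletion only touches vertices whose degree exceeds their capacity, so degrees never drop
  below the capacities and the returned set \<open>Y\<close> satisfies \<open>2 |Y| = (\<Sum>v. d\<^sub>Y(v)) \<ge> (\<Sum>v. c\<^sub>v)\<close>.
  Conversely, each edge of a feasible set can be charged to an endpoint whose degree is within its
  capacity; no vertex \<open>v\<close> is charged more than \<open>c\<^sub>v\<close> times, so \<open>OPT \<le> (\<Sum>v. c\<^sub>v)\<close>.\<close>

lemma degree_mono:
  assumes "finite G" and "F \<subseteq> G"
  shows "degree F v \<le> degree G v"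
  unfolding degree_def using assms by (intro card_mono) auto

text \<open>Handshake lemma, by double counting incidences: every edge has exactly two endpoints,
  both in \<open>V\<close>.\<close>

lemma sum_degree_eq:
  assumes "simple_graph V F" and "finite F"
  shows "(\<Sum>v\<in>V. degree F v) = 2 * card F"
proof -
  have "\<forall>e\<in>F. card {v \<in> V. v \<in> e} = 2"
  proof
    fix e assume "e \<in> F"
    then have "{v \<in> V. v \<in> e} = e" and "card e = 2"
      using assms(1) by (auto simp: simple_graph_def)
    then show "card {v \<in> V. v \<in> e} = 2" by simp
  qed
  then have "(\<Sum>v\<in>V. card {e \<in> F. v \<in> e}) = 2 * card F"
    using assms by (intro sum_multicount) (auto simp: simple_graph_def)
  then show ?thesis by (simp add: degree_def)
qed

lemma delete_step_subset: "delete_step c e Y \<subseteq> Y"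
  by (auto simp: delete_step_def)

lemma fold_delete_step_subset: "fold (delete_step c) es Y \<subseteq> Y"
proof (induction es arbitrary: Y)
  case (Cons e es)
  then show ?case using delete_step_subset[of c e Y] by (auto dest: subsetD)
qed simp

text \<open>The loop invariant: a deletion costs an endpoint at most one degree and requires strict
  excess there beforehand.\<close>

lemma degree_delete_step_ge:
  assumes "c v \<le> degree Y v"
  shows "c v \<le> degree (delete_step c e Y) v"
proof (cases "v \<in> e \<and> (\<forall>x\<in>e. degree Y x > c x)")
  case True
  \<comment> \<open>Only an inequality follows for the degrees, since \<open>e\<close> need not lie
    in \<open>Y\<close>.\<close>
  have "{f \<in> Y - {e}. v \<in> f} = {f \<in> Y. v \<in> f} - {e}" by auto
  then have "degree Y v - 1 \<le> degree (Y - {e}) v"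
    by (simp add: degree_def card_Diff_singleton_if)
  moreover have "c v < degree Y v" using True by blast
  ultimately have "c v \<le> degree (Y - {e}) v" by linarith
  then show ?thesis using True by (simp add: delete_step_def)
next
  case False
  \<comment> \<open>Either \<open>e\<close> is kept or it misses \<open>v\<close>, so the edges at
    \<open>v\<close> stay the same.\<close>
  then have "{f \<in> delete_step c e Y. v \<in> f} = {f \<in> Y. v \<in> f}"
    by (auto simp: delete_step_def)
  then show ?thesis using assms by (simp add: degree_def)
qed

lemma degree_fold_delete_step_ge:
  "c v \<le> degree Y v \<Longrightarrow> c v \<le> degree (fold (delete_step c) es Y) v"
  by (induction es arbitrary: Y) (simp_all add: degree_delete_step_ge)

text \<open>The source of feasibility: an edge that survives its own examination has an endpoint
  within capacity at that moment, and later deletions only lower degrees.\<close>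

lemma fold_delete_step_saturated:
  assumes "finite Y" and "e \<in> set es" and "e \<in> fold (delete_step c) es Y"
  shows "\<exists>x\<in>e. degree (fold (delete_step c) es Y) x \<le> c x"
  using assms
proof (induction es arbitrary: Y)
  case (Cons f es)
  let ?Z = "delete_step c f Y"
  have Z: "finite ?Z" using Cons.prems(1) delete_step_subset by (rule finite_subset[rotated])
  show ?case
  proof (cases "e = f")
    case True
    \<comment> \<open>The edge set only shrinks, so presence at the end means that the deletion test
      failed at this step.\<close>
    then have "f \<in> ?Z" using Cons.prems(3) fold_delete_step_subset by fastforce
    then obtain x where "x \<in> f" "degree Y x \<le> c x"
      by (auto simp: delete_step_def not_less split: if_splits)
    moreover have "degree (fold (delete_step c) (f # es) Y) x \<le> degree Y x"
      using Cons.prems(1) fold_delete_step_subset by (rule degree_mono)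
    ultimately show ?thesis using True by (meson le_trans)
  next
    case False
    then show ?thesis using Cons.IH[OF Z] Cons.prems by simp
  qed
qed simp

lemma card_feasible_le:
  assumes G: "simple_graph V E" and "finite E" and F: "feasible E c F"
  shows "card F \<le> (\<Sum>v\<in>V. c v)"
proof -
  define A where "A = {v \<in> V. degree F v \<le> c v}"
  have FE: "F \<subseteq> E" and "finite V"
    using F G by (auto simp: feasible_def simple_graph_def)
  then have fin: "finite F" "finite A"
    using \<open>finite E\<close> by (auto intro: finite_subset simp: A_def)
  \<comment> \<open>Feasibility says that the stars of the chargeable vertices \<open>A\<close>
    cover \<open>F\<close>. An edge with both ends in \<open>A\<close> is counted twice below, which
    is harmless for an upper bound.\<close>
  have "F \<subseteq> (\<Union>v\<in>A. {e \<in> F. v \<in> e})"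
  proof
    fix e assume e: "e \<in> F"
    then have "e \<subseteq> V" "card e = 2" using FE G by (auto simp: simple_graph_def)
    then obtain u v where "e = {u, v}" "u \<in> V" "v \<in> V" by (auto simp: card_2_iff)
    moreover from this have "degree F u \<le> c u \<or> degree F v \<le> c v"
      using F e by (simp add: feasible_def)
    ultimately show "e \<in> (\<Union>v\<in>A. {e \<in> F. v \<in> e})"
      using e by (auto simp: A_def)
  qed
  then have "card F \<le> card (\<Union>v\<in>A. {e \<in> F. v \<in> e})"
    using fin by (intro card_mono) auto
  also have "\<dots> \<le> (\<Sum>v\<in>A. degree F v)"
    unfolding degree_def using fin(2) by (rule card_UN_le)
  also have "\<dots> \<le> (\<Sum>v\<in>A. c v)"
    by (intro sum_mono) (simp add: A_def)
  also have "\<dots> \<le> (\<Sum>v\<in>V. c v)"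
    using \<open>finite V\<close> by (intro sum_mono2) (auto simp: A_def)
  finally show ?thesis .
qed

lemma OPT_le_sum:
  assumes "simple_graph V E" and "finite E"
  shows "OPT E c \<le> (\<Sum>v\<in>V. c v)"
proof -
  have "{card F | F. feasible E c F} \<subseteq> {..\<Sum>v\<in>V. c v}"
    using card_feasible_le[OF assms] by auto
  \<comment> \<open>\<open>Max\<close> is meaningful only on a finite nonempty set: the bound itself
    gives finiteness, the empty packing nonemptiness.\<close>
  moreover from this have "finite {card F | F. feasible E c F}"
    by (rule finite_subset) simp
  moreover have "feasible E c {}" by (simp add: feasible_def)
  ultimately show ?thesis unfolding OPT_def by (subst Max_le_iff) auto
qed

theorem theorem2:
  fixes V :: "'v set" and E :: "'v set set" and c :: "'v \<Rightarrow> nat" and es :: "'v set list"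
  assumes "connected_graph V E"
    and "\<forall>v\<in>V. c v \<le> degree E v"
    and "distinct es" and "set es = E"
  shows "feasible E c (edge_deletion E c es) \<and>
         real (card (edge_deletion E c es)) \<ge> real (OPT E c) / 2"
proof
  let ?Y = "edge_deletion E c es"
  have G: "simple_graph V E" using assms(1) by (simp add: connected_graph_def)
  have E: "finite E" using assms(4) by auto
  have YE: "?Y \<subseteq> E" unfolding edge_deletion_def by (rule fold_delete_step_subset)
  show "feasible E c ?Y"
    unfolding feasible_def
  proof (intro conjI allI impI)
    fix u v assume "{u, v} \<in> ?Y"
    then have "\<exists>x\<in>{u, v}. degree ?Y x \<le> c x"
      using YE assms(4) fold_delete_step_saturated[OF E, of "{u, v}" es c]
      by (auto simp: edge_deletion_def)
    then show "degree ?Y u \<le> c u \<or> degree ?Y v \<le> c v" by simp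
  qed (rule YE)
  have "OPT E c \<le> (\<Sum>v\<in>V. c v)" using G E by (rule OPT_le_sum)
  \<comment> \<open>The hypothesis \<open>c v \<le> degree E v\<close> starts the invariant at the
    full edge set.\<close>
  also have "\<dots> \<le> (\<Sum>v\<in>V. degree ?Y v)"
    unfolding edge_deletion_def using assms(2)
    by (intro sum_mono degree_fold_delete_step_ge) simp
  also have "\<dots> = 2 * card ?Y"
    using G YE finite_subset[OF YE E]
    by (intro sum_degree_eq) (auto simp: simple_graph_def)
  finally show "real (card ?Y) \<ge> real (OPT E c) / 2" by simp
qed

end
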